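(* Let $E$ be a finite-valued quasi-convex function. If $E\in\nabla_2$ near infinity, then $\Lambda^E(0,1)$ is uniformly sub-diagonal, that is, $$\Lambda^E(0,1)=\bigcup\{L^A(0,1): A\text{ is a Young function such that }L^A(0,1)\overset{*}{\hookrightarrow}\Lambda^E(0,1)\}.$$
   Context: A function $A:[0,\infty]\to[0,\infty]$ is quasi-convex if it is left-continuous, not identically zero or infinity on $(0,\infty]$, $A(0)=0$, and $t\mapsto A(t)/t$ is non-decreasing on $(0,\infty)$; it is a Young function if moreover convex. "Finite-valued" means $E(t)<\infty$ for $t\in[0,\infty)$. $E\in\nabla_2$ near infinity means that there are $c>0$ and $t_0\in(0,\infty)$ such that $2cE(t)\le E(ct)$ for all $t\ge t_0$. All spaces consist of measurable functions on $(0,1)$ with Lebesgue measure; $f_*(\lambda)=|\{|f|>\lambda\}|$. $L^A(0,1)$ is the set of $f$ with $\|f\|_{L^A}=\inf\{\lambda>0:\int_0^1A(|f|/\lambda)\le1\}<\infty$. $\Lambda^E(0,1)$ is the set of $f$ with $\|f\|_{\Lambda^E}=\int_0^\infty E^{-1}_\#(f_*(\lambda))\,d\lambda<\infty$, where $E^{-1}(t)=\sup\{\tau\ge0:E(\tau)\le t\}$ and $E^{-1}_\#(t)=1/E^{-1}(1/t)$ (with $1/0=\infty$, $1/\infty=0$). The almost-compact embedding $X\overset{*}{\hookrightarrow}Y$ means that for every sequence $\{E_n\}$ of measurable sets with $\chi_{E_n}\to0$ a.e. one has $\lim_{n\to\infty}\sup_{\|f\|_X\le1}\|f\chi_{E_n}\|_Y=0$.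 *)

theory Defs
  imports "HOL-Analysis.Analysis"
begin

text \<open>The half-line \<open>[0,\<infinity>]\<close> is the type \<^typ>\<open>ennreal\<close>, where \<open>1 / 0 = \<infinity>\<close>, \<open>1 / \<infinity> = 0\<close>
  and \<open>0 * \<infinity> = 0\<close>.\<close>

text \<open>At \<open>0\<close> the filter \<^term>\<open>at_left (0::ennreal)\<close> is trivial, so the first condition says that
  \<open>A\<close> is left-continuous on \<open>(0,\<infinity>]\<close>, the point \<open>\<infinity>\<close> included.\<close>

definition quasi_convex :: "(ennreal \<Rightarrow> ennreal) \<Rightarrow> bool" where
  "quasi_convex A \<longleftrightarrow>
     (\<forall>t. continuous (at_left t) A) \<and>
     \<not> (\<forall>t>0. A t = 0) \<and> \<not> (\<forall>t>0. A t = \<infinity>) \<and>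
     A 0 = 0 \<and>
     (\<forall>s t. 0 < s \<longrightarrow> s \<le> t \<longrightarrow> t < \<infinity> \<longrightarrow> A s / s \<le> A t / t)"

definition young_function :: "(ennreal \<Rightarrow> ennreal) \<Rightarrow> bool" where
  "young_function A \<longleftrightarrow> quasi_convex A \<and>
     (\<forall>s t u v. u + v = 1 \<longrightarrow> A (u * s + v * t) \<le> u * A s + v * A t)"

definition finite_valued :: "(ennreal \<Rightarrow> ennreal) \<Rightarrow> bool" where
  "finite_valued E \<longleftrightarrow> (\<forall>t<\<infinity>. E t < \<infinity>)"

definition nabla2_near_infinity :: "(ennreal \<Rightarrow> ennreal) \<Rightarrow> bool" where
  "nabla2_near_infinity E \<longleftrightarrow>
     (\<exists>c t0. 0 < c \<and> c < \<infinity> \<and> 0 < t0 \<and> t0 < \<infinity> \<and>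
        (\<forall>t\<ge>t0. t < \<infinity> \<longrightarrow> 2 * c * E t \<le> E (c * t)))"

text \<open>Functions on \<open>(0,1)\<close> are represented by functions \<^typ>\<open>real \<Rightarrow> real\<close> whose values outside
  \<open>(0,1)\<close> are irrelevant. Norms are extended-valued.\<close>

abbreviation unit_interval :: "real measure" where
  "unit_interval \<equiv> lebesgue_on {0<..<1}"

definition distr_fun :: "(real \<Rightarrow> real) \<Rightarrow> real \<Rightarrow> ennreal" where
  "distr_fun f l = emeasure unit_interval {x \<in> {0<..<1}. \<bar>f x\<bar> > l}"

definition orlicz_norm :: "(ennreal \<Rightarrow> ennreal) \<Rightarrow> (real \<Rightarrow> real) \<Rightarrow> ennreal" where
  "orlicz_norm A f =
     Inf {r. 0 < r \<and> r < \<infinity> \<and> (\<integral>\<^sup>+x. A (ennreal \<bar>f x\<bar> / r) \<partial>unit_interval) \<le> 1}"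

definition orlicz_space :: "(ennreal \<Rightarrow> ennreal) \<Rightarrow> (real \<Rightarrow> real) set" where
  "orlicz_space A = {f \<in> borel_measurable unit_interval. orlicz_norm A f < \<infinity>}"

definition right_inverse :: "(ennreal \<Rightarrow> ennreal) \<Rightarrow> ennreal \<Rightarrow> ennreal" where
  "right_inverse E t = Sup {\<tau>. E \<tau> \<le> t}"

definition sharp_inverse :: "(ennreal \<Rightarrow> ennreal) \<Rightarrow> ennreal \<Rightarrow> ennreal" where
  "sharp_inverse E t = 1 / right_inverse E (1 / t)"

definition lambda_norm :: "(ennreal \<Rightarrow> ennreal) \<Rightarrow> (real \<Rightarrow> real) \<Rightarrow> ennreal" where
  "lambda_norm E f = (\<integral>\<^sup>+l\<in>{0<..}. sharp_inverse E (distr_fun f l) \<partial>lborel)"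

definition lambda_space :: "(ennreal \<Rightarrow> ennreal) \<Rightarrow> (real \<Rightarrow> real) set" where
  "lambda_space E = {f \<in> borel_measurable unit_interval. lambda_norm E f < \<infinity>}"

text \<open>A space of measurable functions enters only through its extended-valued norm, which is finite
  exactly on the space; hence the unit ball is the set of measurable functions of norm at most 1.\<close>

definition almost_compact_embedding ::
  "((real \<Rightarrow> real) \<Rightarrow> ennreal) \<Rightarrow> ((real \<Rightarrow> real) \<Rightarrow> ennreal) \<Rightarrow> bool" where
  "almost_compact_embedding normX normY \<longleftrightarrow>
     (\<forall>S :: nat \<Rightarrow> real set.
        (\<forall>n. S n \<in> sets unit_interval) \<longrightarrow>
        (AE x in unit_interval. (\<lambda>n. indicator (S n) x :: real) \<longlonglongrightarrow> 0) \<longrightarrow>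
        (\<lambda>n. SUP f \<in> {f \<in> borel_measurable unit_interval. normX f \<le> 1}.
                normY (\<lambda>x. f x * indicator (S n) x)) \<longlonglongrightarrow> 0)"

end

theory Submission imports Defs begin

text \<open>Write \<open>P\<close> for \<^const>\<open>sharp_inverse\<close> \<open>E\<close> and \<open>f\<^sub>*\<close> for \<^const>\<open>distr_fun\<close> \<open>f\<close>, so that the norm of
  \<open>\<Lambda>\<^sup>E\<close> is \<open>\<integral> P (f\<^sub>* \<lambda>) d\<lambda>\<close>. Since \<open>E t / t\<close> increases, \<open>P\<close> is quasi-concave: \<open>P\<close> increases
  and \<open>P t / t\<close> decreases. Since \<open>E\<close> is finite-valued, \<open>P t \<rightarrow> 0\<close> as \<open>t \<rightarrow> 0\<close>.

  Given \<open>f\<close> in \<open>\<Lambda>\<^sup>E\<close>, put \<open>m = f\<^sub>*\<close>, raised to \<open>1\<close> on \<open>(0,1)\<close>, and let \<open>A\<close> be the primitive of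
  \<open>a \<lambda> = P (m \<lambda>) / m \<lambda>\<close>. As \<open>m\<close> decreases and \<open>P t / t\<close> decreases, \<open>a\<close> increases, so \<open>A\<close> is convex
  (\<open>young_function_primitive\<close>). By the layer-cake formula (\<open>nn_integral_primitive\<close>)
  \<open>\<integral> A \<bar>f\<bar> = \<integral> a f\<^sub>* \<le> \<integral> P m < \<infinity>\<close>, so \<open>f\<close> lies in \<open>L\<^sup>A\<close>. Conversely let \<open>\<integral> A \<bar>g\<bar> = \<integral> a g\<^sub>* \<le> 1\<close>.
  Where \<open>g\<^sub>* \<le> m\<close> the value \<open>P g\<^sub>*\<close> is at most \<open>P m\<close>; where \<open>g\<^sub>* > m\<close> quasi-concavity gives
  \<open>P g\<^sub>* \<le> (P m / m) g\<^sub>* = a g\<^sub>*\<close>. Both bounds are integrable, hence \<open>L\<^sup>A\<close> embeds in \<open>\<Lambda>\<^sup>E\<close>.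

  The \<open>\<nabla>\<^sub>2\<close> condition makes this embedding almost compact. It says that
  \<open>P (2 q t) \<le> q P t\<close> for some \<open>q \<ge> 1\<close> and all small \<open>t\<close>. Splitting at \<open>g\<^sub>* = (2 q)\<^sup>n m\<close> instead of
  \<open>g\<^sub>* = m\<close> then gives \<open>P g\<^sub>* \<le> q\<^sup>n P m + 2\<^sup>-\<^sup>n a g\<^sub>*\<close> as soon as \<open>m\<close> is small, that is, for large \<open>\<lambda>\<close>
  (\<open>nabla2_interpolation\<close>). The integral of the second term is at most \<open>2\<^sup>-\<^sup>n\<close>, and that of the
  first over \<open>\<lambda> > N\<close> is small for large \<open>N\<close>. On \<open>\<lambda> \<le> N\<close> the distribution function of \<open>g \<chi>\<^sub>S\<close> is at
  most \<open>\<bar>S\<bar>\<close>, which contributes at most \<open>N P \<bar>S\<bar>\<close>, small with \<open>\<bar>S\<bar>\<close>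
  (\<open>almost_compact_embedding_primitive\<close>).

  The other inclusion holds because an almost-compact embedding, applied to the sets \<open>{\<bar>g\<bar> > n}\<close>
  of a single function \<open>g\<close>, makes the unbounded part of \<open>g\<close> an element of \<open>\<Lambda>\<^sup>E\<close>, and bounded
  functions belong to \<open>\<Lambda>\<^sup>E\<close> anyway (\<open>almost_compact_embedding_imp_subset\<close>).\<close>

section \<open>The right inverse of a quasi-convex function\<close>

lemma quasi_convex_star_shaped:
  assumes "quasi_convex E" "0 \<le> k" "k \<le> 1" "t < \<infinity>"
  shows "E (ennreal k * t) \<le> ennreal k * E t"
proof (cases "k = 0 \<or> t = 0")
  case True
  then show ?thesis using assms by (auto simp: quasi_convex_def)
next
  case False
  have kt: "0 < ennreal k * t" "ennreal k * t \<le> t"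
    using False assms mult_right_mono[of "ennreal k" 1 t]
    by (auto simp: ennreal_zero_less_mult_iff zero_less_iff_neq_zero)
  have "E (ennreal k * t) / (ennreal k * t) \<le> E t / t"
    using assms kt by (auto simp: quasi_convex_def)
  then have "E (ennreal k * t) / (ennreal k * t) * (ennreal k * t) \<le> E t / t * (ennreal k * t)"
    by (rule mult_right_mono) simp
  moreover have "ennreal k * t / (ennreal k * t) = 1"
    using kt assms by (intro ennreal_divide_self) (auto simp: ennreal_mult_less_top)
  then have "E (ennreal k * t) / (ennreal k * t) * (ennreal k * t) = E (ennreal k * t)"
    by (simp add: ennreal_divide_times)
  moreover have "E t / t * (ennreal k * t) = ennreal k * (E t * (t / t))"
    by (simp add: ennreal_divide_times ennreal_times_divide mult_ac)
  moreover have "t / t = 1" using False assms by (simp add: zero_less_iff_neq_zero)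
  ultimately show ?thesis by simp
qed

lemma at_left_top_ennreal_nontrivial: "at_left (\<infinity>::ennreal) \<noteq> bot"
proof
  assume "at_left (\<infinity>::ennreal) = bot"
  then have "eventually (\<lambda>_. False) (at_left (\<infinity>::ennreal))" by simp
  then obtain b :: ennreal where "b < \<infinity>" "\<And>y. b < y \<Longrightarrow> y < \<infinity> \<Longrightarrow> False"
    by (subst (asm) eventually_at_left[of 0]) auto
  then show False using dense by blast
qed

text \<open>The bound includes \<open>t = \<infinity>\<close>: on finite arguments \<open>E\<close> grows at least linearly from some point on,
  and left-continuity at \<open>\<infinity>\<close> carries this over to \<open>E \<infinity>\<close>. Left-continuity also excludes that \<open>E\<close>
  is nonzero at \<open>\<infinity>\<close> only.\<close>

lemma quasi_convex_unbounded:
  assumes E: "quasi_convex E" and B: "B < \<infinity>"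
  obtains T where "0 < T" "T < \<infinity>" "\<And>t. T \<le> t \<Longrightarrow> B < E t"
proof -
  have lim: "(E \<longlongrightarrow> E \<infinity>) (at_left \<infinity>)"
    using E by (auto simp: quasi_convex_def continuous_within)
  have "\<exists>t>0. t < \<infinity> \<and> 0 < E t"
  proof (rule ccontr)
    assume *: "\<not> ?thesis"
    have z: "E t = 0" if "0 < t" "t < \<infinity>" for t
      using * that by (metis not_gr_zero)
    have "\<forall>\<^sub>F t in at_left \<infinity>. E t \<le> 0"
      unfolding eventually_at_left[OF ennreal_zero_less_top[unfolded infinity_ennreal_def[symmetric]]]
      using z by (intro exI[of _ 0]) auto
    then have "E \<infinity> \<le> 0"
      by (rule tendsto_upperbound[OF lim _ at_left_top_ennreal_nontrivial])
    then have "\<forall>t>0. E t = 0" using * by (metis le_zero_eq not_gr_zero top.not_eq_extremum infinity_ennreal_def)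
    then show False using E by (auto simp: quasi_convex_def)
  qed
  then obtain d where d: "0 < d" "d < \<infinity>" "0 < E d" by auto
  define e where "e = (if E d = \<infinity> then 1 else E d)"
  have e: "0 < e" "e < \<infinity>" "e \<le> E d" using d by (auto simp: e_def top.not_eq_extremum)
  obtain d' e' b where r: "d = ennreal d'" "e = ennreal e'" "B = ennreal b" "0 < d'" "0 < e'" "0 \<le> b"
    using d e B by (cases d; cases e; cases B) auto
  \<comment> \<open>From \<open>T\<close> on the linear lower bound \<open>E t \<ge> (t / d') e\<close> is at least \<open>b + 1\<close>.\<close>
  define T where "T = max d' (d' * (b + 1) / e')"
  have T: "T > 0" "T \<ge> d'" using r by (auto simp: T_def)
  have fin: "ennreal (b + 1) \<le> E t" if "ennreal T \<le> t" "t < \<infinity>" for t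
  proof -
    obtain s where s: "t = ennreal s" "s \<ge> 0" using \<open>t < \<infinity>\<close> by (cases t) auto
    then have "s \<ge> T" using \<open>ennreal T \<le> t\<close> T by simp
    note s = s(1) this
    have "E d = E (ennreal (d' / s) * ennreal s)"
      using s T r by (simp add: ennreal_mult[symmetric])
    also have "\<dots> \<le> ennreal (d' / s) * E t"
      unfolding s(1) using s T r that by (intro quasi_convex_star_shaped E) auto
    finally have "ennreal (s / d') * e \<le> ennreal (s / d') * (ennreal (d' / s) * E t)"
      using e by (intro mult_left_mono) auto
    also have "\<dots> = E t"
      using s T r by (simp add: mult.assoc[symmetric] ennreal_mult[symmetric])
    finally have "ennreal (s / d') * e \<le> E t" .
    moreover have "ennreal (s / d') * e = ennreal (s / d' * e')"
      unfolding r(2) using r s T by (intro ennreal_mult[symmetric]) auto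
    moreover have "b + 1 \<le> s / d' * e'"
    proof -
      have "d' * (b + 1) / e' \<le> s" using s by (simp add: T_def)
      then show ?thesis using r by (simp add: field_simps)
    qed
    ultimately show ?thesis by (metis ennreal_leI order_trans)
  qed
  have "\<forall>\<^sub>F t in at_left \<infinity>. ennreal (b + 1) \<le> E t"
    unfolding eventually_at_left[OF ennreal_zero_less_top[unfolded infinity_ennreal_def[symmetric]]]
    using fin by (intro exI[of _ "ennreal T"]) auto
  then have "ennreal (b + 1) \<le> E \<infinity>"
    by (rule tendsto_lowerbound[OF lim _ at_left_top_ennreal_nontrivial])
  then have "ennreal (b + 1) \<le> E t" if "ennreal T \<le> t" for t
    using fin[of t] that by (cases "t = \<infinity>") (auto simp: top.not_eq_extremum)
  then have "B < E t" if "ennreal T \<le> t" for t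
    using that r by (metis ennreal_lessI less_add_one less_le_trans add_pos_nonneg zero_less_one add.commute)
  then show ?thesis using that[of "ennreal T"] T by auto
qed

lemma right_inverse_mono: "s \<le> t \<Longrightarrow> right_inverse E s \<le> right_inverse E t"
  unfolding right_inverse_def by (intro Sup_subset_mono) auto

lemma right_inverse_less_top:
  assumes "quasi_convex E" "s < \<infinity>"
  shows "right_inverse E s < \<infinity>"
proof -
  obtain T where T: "T < \<infinity>" "\<And>t. T \<le> t \<Longrightarrow> s < E t"
    using quasi_convex_unbounded[OF assms] by metis
  have "right_inverse E s \<le> T"
    unfolding right_inverse_def using T(2) by (intro Sup_least) (auto simp: not_less[symmetric] intro: less_imp_le)
  then show ?thesis using T by auto
qed

text \<open>Since \<open>E k \<le> k E 1\<close> for \<open>k \<le> 1\<close> and \<open>E 1\<close> is finite, \<open>E\<close> is at most \<open>s\<close> near \<open>0\<close>.\<close>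

lemma right_inverse_pos:
  assumes E: "quasi_convex E" "finite_valued E" and s: "0 < s"
  shows "0 < right_inverse E s"
proof -
  have "E 1 < \<infinity>" using E by (auto simp: finite_valued_def)
  then obtain e where e: "E 1 = ennreal e" "0 \<le> e" by (cases "E 1") auto
  obtain r where r: "0 < r" "ennreal r \<le> s"
  proof (cases s)
    case (real x) then show ?thesis using that[of x] s by auto
  next
    case top then show ?thesis using that[of 1] by auto
  qed
  define k where "k = min 1 (r / (e + 1))"
  have k: "0 < k" "k \<le> 1" "k * e \<le> r"
  proof -
    show "0 < k" "k \<le> 1" using r e by (auto simp: k_def)
    have "k * e \<le> r / (e + 1) * e" using e by (intro mult_right_mono) (auto simp: k_def)
    also have "\<dots> \<le> r" using e r by (simp add: field_simps)
    finally show "k * e \<le> r" .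
  qed
  have "E (ennreal k * 1) \<le> ennreal k * E 1"
    using k by (intro quasi_convex_star_shaped E) auto
  also have "\<dots> \<le> s"
    using e k r by (simp add: ennreal_mult[symmetric]) (meson ennreal_leI order_trans)
  finally have "ennreal k \<le> right_inverse E s"
    unfolding right_inverse_def by (intro Sup_upper) simp
  then show ?thesis using k by (meson ennreal_less_zero_iff less_le_trans)
qed

text \<open>If \<open>E \<tau> \<le> t\<close>, then \<open>E (s \<tau> / t) \<le> s\<close> by \<open>quasi_convex_star_shaped\<close>; take the supremum over \<open>\<tau>\<close>.\<close>

lemma right_inverse_div_antimono:
  assumes E: "quasi_convex E" and st: "0 < s" "s \<le> t"
  shows "ennreal s * right_inverse E (ennreal t) \<le> ennreal t * right_inverse E (ennreal s)"
proof -
  define k where "k = s / t"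
  have k: "0 < k" "k \<le> 1" using st by (auto simp: k_def)
  have "ennreal k * \<tau> \<le> right_inverse E (ennreal s)" if \<tau>: "E \<tau> \<le> ennreal t" for \<tau>
  proof -
    obtain T where "T < \<infinity>" "\<And>u. T \<le> u \<Longrightarrow> ennreal t < E u"
      using quasi_convex_unbounded[OF E, of "ennreal t"] by (metis ennreal_less_top infinity_ennreal_def)
    then have "\<tau> < \<infinity>" using \<tau> by (metis leD not_less order_less_trans)
    then have "E (ennreal k * \<tau>) \<le> ennreal k * E \<tau>"
      using k by (intro quasi_convex_star_shaped E) auto
    also have "\<dots> \<le> ennreal k * ennreal t" using \<tau> by (intro mult_left_mono) auto
    also have "\<dots> = ennreal s" using st k by (simp add: ennreal_mult[symmetric] k_def)
    finally show ?thesis unfolding right_inverse_def by (intro Sup_upper) simp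
  qed
  then have "ennreal k * right_inverse E (ennreal t) \<le> right_inverse E (ennreal s)"
    using SUP_mult_left_ennreal[of "ennreal k" "\<lambda>x. x" "{\<tau>. E \<tau> \<le> ennreal t}"]
    unfolding right_inverse_def[of E "ennreal t"] by (auto intro!: SUP_least)
  then have "ennreal t * (ennreal k * right_inverse E (ennreal t)) \<le> ennreal t * right_inverse E (ennreal s)"
    by (rule mult_left_mono) simp
  also have "ennreal t * (ennreal k * right_inverse E (ennreal t)) = ennreal s * right_inverse E (ennreal t)"
    using st k by (simp add: ennreal_mult[symmetric] mult.assoc[symmetric] k_def)
  finally show ?thesis .
qed

text \<open>With the constant \<open>c\<close> of the \<open>\<nabla>\<^sub>2\<close> condition as \<open>q\<close>: if \<open>E \<tau> \<le> 2 c s\<close> and \<open>\<tau> / c\<close> is large, then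
  \<open>2 c E (\<tau> / c) \<le> E \<tau> \<le> 2 c s\<close>, so that \<open>\<tau> / c\<close> is at most the right inverse at \<open>s\<close>; for smaller
  \<open>\<tau> / c\<close> this is clear once \<open>s \<ge> E t0\<close>.\<close>

lemma nabla2_right_inverse:
  assumes E: "quasi_convex E" "finite_valued E" "nabla2_near_infinity E"
  obtains q s0 :: real where "q \<ge> 1" "s0 > 0"
    "\<And>s. s0 \<le> s \<Longrightarrow> right_inverse E (ennreal (2 * q * s)) \<le> ennreal q * right_inverse E (ennreal s)"
proof -
  obtain c t0 where ct: "0 < c" "c < \<infinity>" "0 < t0" "t0 < \<infinity>"
    and n: "\<And>t. t0 \<le> t \<Longrightarrow> t < \<infinity> \<Longrightarrow> 2 * c * E t \<le> E (c * t)"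
    using E(3) by (auto simp: nabla2_near_infinity_def)
  obtain q where q: "c = ennreal q" "0 < q" using ct by (cases c) auto
  obtain T where T: "0 < T" "T < \<infinity>" "\<And>t. T \<le> t \<Longrightarrow> 0 < E t"
    using quasi_convex_unbounded[OF E(1), of 0] by auto
  \<comment> \<open>Otherwise star-shapedness gives \<open>2 c E t \<le> E (c t) \<le> c E t\<close>, impossible for \<open>0 < E t < \<infinity>\<close>.\<close>
  have q1: "q \<ge> 1"
  proof (rule ccontr)
    assume "\<not> q \<ge> 1"
    then have "q < 1" by simp
    define t where "t = max t0 T"
    have t: "t < \<infinity>" "t0 \<le> t" "0 < E t" using T ct by (auto simp: t_def)
    have "2 * c * E t \<le> E (c * t)" by (rule n) fact+
    also have "\<dots> \<le> c * E t" unfolding q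
      using \<open>q < 1\<close> q t by (intro quasi_convex_star_shaped E) auto
    finally have *: "2 * c * E t \<le> c * E t" .
    obtain e where "E t = ennreal e" "e > 0"
      using t E(2) by (cases "E t") (auto simp: finite_valued_def)
    then show False using * q by (simp add: numeral_mult_ennreal ennreal_mult[symmetric])
  qed
  have "E t0 < \<infinity>" using E ct by (auto simp: finite_valued_def)
  then obtain e0 where e0: "E t0 = ennreal e0" "e0 \<ge> 0" by (cases "E t0") auto
  have "right_inverse E (ennreal (2 * q * s)) \<le> ennreal q * right_inverse E (ennreal s)"
    if s: "max 1 e0 \<le> s" for s
    unfolding right_inverse_def[of E "ennreal (2 * q * s)"]
  proof (rule Sup_least, clarify)
    fix \<tau> assume \<tau>: "E \<tau> \<le> ennreal (2 * q * s)"
    obtain T' where "T' < \<infinity>" "\<And>u. T' \<le> u \<Longrightarrow> ennreal (2 * q * s) < E u"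
      using quasi_convex_unbounded[OF E(1), of "ennreal (2 * q * s)"] by (metis ennreal_less_top infinity_ennreal_def)
    then have "\<tau> < \<infinity>" using \<tau> by (metis leD not_less order_less_trans)
    then obtain x where x: "\<tau> = ennreal x" "x \<ge> 0" by (cases \<tau>) auto
    define y where "y = ennreal (x / q)"
    have y: "c * y = \<tau>" using x q by (simp add: y_def ennreal_mult[symmetric])
    have "y \<le> right_inverse E (ennreal s)"
    proof (cases "t0 \<le> y")
      case True
      have "2 * c * E y \<le> E (c * y)" using True by (intro n) (auto simp: y_def)
      also have "\<dots> \<le> ennreal (2 * q) * ennreal s" using \<tau> q(2) s unfolding y by (simp add: ennreal_mult[symmetric])
      also have "ennreal (2 * q) = 2 * c" using q by (simp add: ennreal_mult)
      finally have "E y \<le> ennreal s"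
        using q by (subst (asm) ennreal_mult_le_mult_iff) (auto simp: ennreal_mult_eq_top_iff)
      then show ?thesis unfolding right_inverse_def by (intro Sup_upper) simp
    next
      case False
      have "t0 \<le> right_inverse E (ennreal s)"
        unfolding right_inverse_def using e0 s by (intro Sup_upper) auto
      with False show ?thesis by simp
    qed
    then have "c * y \<le> c * right_inverse E (ennreal s)" by (rule mult_left_mono) simp
    then show "\<tau> \<le> ennreal q * right_inverse E (ennreal s)" using y q by simp
  qed
  then show ?thesis using that[of q "max 1 e0"] q1 by auto
qed

section \<open>The fundamental function\<close>

lemma sharp_inverse_0: "sharp_inverse E 0 = 0"
  by (simp add: sharp_inverse_def right_inverse_def)

lemma ennreal_inverse_antimono: "(a::ennreal) \<le> b \<Longrightarrow> inverse b \<le> inverse a"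
  by (simp add: less_eq_ennreal.rep_eq inverse_ennreal.rep_eq ereal_inverse_antimono)

lemma sharp_inverse_mono: "s \<le> t \<Longrightarrow> sharp_inverse E s \<le> sharp_inverse E t"
  unfolding sharp_inverse_def divide_ennreal_def
  by (intro mult_left_mono ennreal_inverse_antimono right_inverse_mono) auto

lemma sharp_inverse_real:
  assumes E: "quasi_convex E" "finite_valued E" and t: "0 < t"
  obtains r where "0 < r" "right_inverse E (ennreal (1 / t)) = ennreal r"
    "sharp_inverse E (ennreal t) = ennreal (1 / r)"
proof -
  have 1: "1 / ennreal t = ennreal (1 / t)" using t by (simp add: divide_ennreal ennreal_1[symmetric] del: ennreal_1)
  obtain r where r: "right_inverse E (ennreal (1 / t)) = ennreal r" "0 < r"
    using right_inverse_pos[OF E, of "ennreal (1 / t)"] right_inverse_less_top[OF E(1), of "ennreal (1 / t)"] t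
    by (cases "right_inverse E (ennreal (1 / t))") auto
  then show ?thesis
    using that[of r] by (simp add: sharp_inverse_def 1) (simp add: divide_ennreal_def inverse_ennreal inverse_eq_divide)
qed

lemma sharp_inverse_pos:
  assumes "quasi_convex E" "finite_valued E" "0 < t"
  shows "0 < sharp_inverse E (ennreal t)"
  using sharp_inverse_real[OF assms] by (metis ennreal_less_zero_iff zero_less_divide_1_iff)

lemma sharp_inverse_less_top:
  assumes "quasi_convex E" "finite_valued E" "t < \<infinity>"
  shows "sharp_inverse E t < \<infinity>"
proof (cases "t = 0")
  case False
  then obtain r where "t = ennreal r" "0 < r" using assms by (cases t) auto
  then show ?thesis using sharp_inverse_real[OF assms(1,2)] by (metis ennreal_less_top infinity_ennreal_def)
qed (simp add: sharp_inverse_0)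

lemma sharp_inverse_quasi_concave:
  assumes E: "quasi_convex E" "finite_valued E" and st: "0 < s" "s \<le> t"
  shows "ennreal s * sharp_inverse E (ennreal t) \<le> ennreal t * sharp_inverse E (ennreal s)"
proof -
  obtain x where x: "0 < x" "right_inverse E (ennreal (1 / t)) = ennreal x"
    "sharp_inverse E (ennreal t) = ennreal (1 / x)"
    using sharp_inverse_real[OF E, of t] st by auto
  obtain y where y: "0 < y" "right_inverse E (ennreal (1 / s)) = ennreal y"
    "sharp_inverse E (ennreal s) = ennreal (1 / y)"
    using sharp_inverse_real[OF E, of s] st by auto
  have "ennreal (1 / t) * ennreal y \<le> ennreal (1 / s) * ennreal x"
    using right_inverse_div_antimono[OF E(1), of "1 / t" "1 / s"] st x y by (simp add: field_simps)
  then have "1 / t * y \<le> 1 / s * x" using st x y by (simp add: ennreal_mult[symmetric])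
  then have "s * (1 / x) \<le> t * (1 / y)" using st x y by (simp add: field_simps)
  then show ?thesis using st x y by (simp add: ennreal_mult[symmetric])
qed

text \<open>The right inverse at \<open>E (1 / e)\<close>, a finite number, is at least \<open>1 / e\<close>.\<close>

lemma sharp_inverse_small_near_0:
  assumes E: "quasi_convex E" "finite_valued E" and e: "0 < e"
  obtains d where "0 < d" "sharp_inverse E (ennreal d) \<le> ennreal e"
proof -
  have "E (ennreal (1 / e)) < \<infinity>" using E by (auto simp: finite_valued_def)
  then obtain b where b: "E (ennreal (1 / e)) = ennreal b" "b \<ge> 0" by (cases "E (ennreal (1 / e))") auto
  define d where "d = 1 / (b + 1)"
  have d: "0 < d" "1 / d = b + 1" using b by (auto simp: d_def)
  obtain r where r: "0 < r" "right_inverse E (ennreal (1 / d)) = ennreal r"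
    "sharp_inverse E (ennreal d) = ennreal (1 / r)"
    using sharp_inverse_real[OF E d(1)] by auto
  have "ennreal (1 / e) \<le> ennreal r"
    unfolding r(2)[symmetric] right_inverse_def using b d by (intro Sup_upper) (auto intro: ennreal_leI)
  then have "1 / e \<le> r" using r by simp
  then have "1 / r \<le> e" using r e by (simp add: field_simps)
  then show ?thesis using that[of d] d r by (auto intro: ennreal_leI)
qed

text \<open>The bound on \<open>(2 * q) ^ n * t\<close> keeps all intermediate points \<open>(2 * q) ^ k * t\<close> in the range where
  the one-step inequality is available.\<close>

lemma nabla2_sharp_inverse:
  assumes E: "quasi_convex E" "finite_valued E" "nabla2_near_infinity E"
  obtains q d :: real where "q \<ge> 1" "d > 0"
    "\<And>n t. 0 < t \<Longrightarrow> (2 * q) ^ n * t \<le> d \<Longrightarrow>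
       sharp_inverse E (ennreal ((2 * q) ^ n * t)) \<le> ennreal (q ^ n) * sharp_inverse E (ennreal t)"
proof -
  obtain q s0 :: real where q: "q \<ge> 1" "s0 > 0" and
    R: "\<And>s. s0 \<le> s \<Longrightarrow> right_inverse E (ennreal (2 * q * s)) \<le> ennreal q * right_inverse E (ennreal s)"
    using nabla2_right_inverse[OF E] by metis
  define d where "d = 1 / s0"
  have one: "sharp_inverse E (ennreal (2 * q * t)) \<le> ennreal q * sharp_inverse E (ennreal t)"
    if t: "0 < t" "2 * q * t \<le> d" for t
  proof -
    obtain x where x: "0 < x" "right_inverse E (ennreal (1 / (2 * q * t))) = ennreal x"
      "sharp_inverse E (ennreal (2 * q * t)) = ennreal (1 / x)"
      using sharp_inverse_real[OF E(1,2), of "2 * q * t"] t q by auto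
    obtain y where y: "0 < y" "right_inverse E (ennreal (1 / t)) = ennreal y"
      "sharp_inverse E (ennreal t) = ennreal (1 / y)"
      using sharp_inverse_real[OF E(1,2), of t] t by auto
    have "s0 \<le> 1 / (2 * q * t)" using t q by (simp add: d_def field_simps)
    from R[OF this] have "ennreal y \<le> ennreal q * ennreal x"
      using q x y by simp
    then have "y \<le> q * x" using q x y by (simp add: ennreal_mult[symmetric])
    then have "1 / x \<le> q * (1 / y)" using q x y by (simp add: field_simps)
    then show ?thesis using q x y by (simp add: ennreal_mult[symmetric])
  qed
  have "sharp_inverse E (ennreal ((2 * q) ^ n * t)) \<le> ennreal (q ^ n) * sharp_inverse E (ennreal t)"
    if t: "0 < t" "(2 * q) ^ n * t \<le> d" for n t
    using t(2)
  proof (induction n)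
    case (Suc n)
    have eq: "(2 * q) ^ Suc n * t = 2 * q * ((2 * q) ^ n * t)" by simp
    have pos: "0 < (2 * q) ^ n * t" using q t by simp
    have "1 * ((2 * q) ^ n * t) \<le> 2 * q * ((2 * q) ^ n * t)"
      using q pos by (intro mult_right_mono) auto
    then have IH: "sharp_inverse E (ennreal ((2 * q) ^ n * t)) \<le> ennreal (q ^ n) * sharp_inverse E (ennreal t)"
      using Suc unfolding eq by linarith
    have "sharp_inverse E (ennreal ((2 * q) ^ Suc n * t)) \<le> ennreal q * sharp_inverse E (ennreal ((2 * q) ^ n * t))"
      using one[OF pos] Suc.prems unfolding eq by simp
    also have "\<dots> \<le> ennreal q * (ennreal (q ^ n) * sharp_inverse E (ennreal t))"
      by (intro mult_left_mono IH) simp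
    also have "\<dots> = ennreal (q ^ Suc n) * sharp_inverse E (ennreal t)"
      using q by (simp add: mult.assoc[symmetric] ennreal_mult)
    finally show ?case .
  qed simp
  then show ?thesis using that[of q d] q by (auto simp: d_def)
qed

section \<open>Primitives of monotone functions\<close>

lemma borel_measurable_mono_ennreal:
  fixes h :: "real \<Rightarrow> ennreal"
  assumes "mono h"
  shows "h \<in> borel_measurable borel"
proof (rule borel_measurableI_greater)
  fix y
  have "is_interval {x. y < h x}"
    unfolding is_interval_1 using monoD[OF assms] by (auto intro: less_le_trans)
  then show "{x \<in> space borel. y < h x} \<in> sets borel"
    by (simp add: real_interval_borel_measurable)
qed

lemma borel_measurable_antimono_ennreal:
  fixes h :: "real \<Rightarrow> ennreal"
  assumes "antimono h"
  shows "h \<in> borel_measurable borel"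
proof -
  have "mono (\<lambda>x. h (- x))" using assms by (auto simp: mono_def antimono_def)
  from borel_measurable_mono_ennreal[OF this]
  have "(\<lambda>x. h (- (- x))) \<in> borel_measurable borel" by measurable
  then show ?thesis by simp
qed

definition primitive :: "(real \<Rightarrow> ennreal) \<Rightarrow> ennreal \<Rightarrow> ennreal" where
  "primitive a t = (\<integral>\<^sup>+l\<in>{0<..}. a l * indicator {l. ennreal l < t} l \<partial>lborel)"

lemma primitive_mono: "s \<le> t \<Longrightarrow> primitive a s \<le> primitive a t"
  unfolding primitive_def by (intro nn_integral_mono mult_right_mono mult_left_mono) (auto simp: indicator_def)

lemma primitive_0: "primitive a 0 = 0"
  unfolding primitive_def by simp

lemma primitive_ennreal: "0 \<le> s \<Longrightarrow> primitive a (ennreal s) = (\<integral>\<^sup>+l. a l * indicator {0<..<s} l \<partial>lborel)"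
  unfolding primitive_def
  by (intro nn_integral_cong) (auto simp: indicator_def ennreal_less_iff)

text \<open>The two inequalities below are the substitute for a supporting line of slope \<open>a p\<close> at \<open>p\<close>; they
  are stated without subtraction because all values may be infinite.\<close>

lemma primitive_le_tangent:
  assumes a: "mono a" and sp: "0 \<le> s" "s \<le> p"
  shows "primitive a (ennreal p) \<le> primitive a (ennreal s) + a p * ennreal (p - s)"
proof -
  have [measurable]: "a \<in> borel_measurable borel" by (rule borel_measurable_mono_ennreal[OF a])
  have "primitive a (ennreal p) = (\<integral>\<^sup>+l. a l * indicator {0<..<p} l \<partial>lborel)"
    using sp by (intro primitive_ennreal) auto
  also have "\<dots> \<le> (\<integral>\<^sup>+l. a l * indicator {0<..<s} l + a p * indicator {s..<p} l \<partial>lborel)"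
    using monoD[OF a] by (intro nn_integral_mono) (auto simp: indicator_def)
  also have "\<dots> = primitive a (ennreal s) + a p * ennreal (p - s)"
    using sp by (simp add: nn_integral_add primitive_ennreal nn_integral_cmult_indicator)
  finally show ?thesis .
qed

lemma primitive_ge_tangent:
  assumes a: "mono a" and pt: "0 \<le> p" "p \<le> t"
  shows "primitive a (ennreal p) + a p * ennreal (t - p) \<le> primitive a (ennreal t)"
proof -
  have [measurable]: "a \<in> borel_measurable borel" by (rule borel_measurable_mono_ennreal[OF a])
  have "a p * ennreal (t - p) = a p * emeasure lborel {p<..<t}" using pt by simp
  then have "primitive a (ennreal p) + a p * ennreal (t - p) =
      (\<integral>\<^sup>+l. a l * indicator {0<..<p} l + a p * indicator {p<..<t} l \<partial>lborel)"
    using pt by (simp add: nn_integral_add primitive_ennreal nn_integral_cmult_indicator)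
  also have "\<dots> \<le> (\<integral>\<^sup>+l. a l * indicator {0<..<t} l \<partial>lborel)"
    using monoD[OF a] pt by (intro nn_integral_mono) (auto simp: indicator_def)
  also have "\<dots> = primitive a (ennreal t)"
    using pt by (intro primitive_ennreal[symmetric]) auto
  finally show ?thesis .
qed

lemma primitive_top:
  assumes a: "mono a" and pos: "\<And>l. 0 < l \<Longrightarrow> 0 < a l"
  shows "primitive a \<infinity> = \<infinity>"
proof (rule ccontr)
  assume "primitive a \<infinity> \<noteq> \<infinity>"
  then obtain r where r: "primitive a \<infinity> = ennreal r" "0 \<le> r" by (cases "primitive a \<infinity>") auto
  obtain e where e: "0 < e" "ennreal e \<le> a 1"
  proof (cases "a 1")
    case (real x) then show ?thesis using that[of x] pos[of 1] by auto
  next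
    case top then show ?thesis using that[of 1] by auto
  qed
  define t where "t = 1 + (r + 1) / e"
  have t: "1 \<le> t" using r e by (simp add: t_def)
  have "ennreal (e * (t - 1)) = ennreal e * ennreal (t - 1)" using e t by (simp add: ennreal_mult)
  also have "\<dots> \<le> a 1 * ennreal (t - 1)" by (intro mult_right_mono e) simp
  also have "\<dots> \<le> primitive a (ennreal 1) + a 1 * ennreal (t - 1)" by simp
  also have "\<dots> \<le> primitive a (ennreal t)" using t by (intro primitive_ge_tangent a) auto
  also have "\<dots> \<le> ennreal r" unfolding r(1)[symmetric] by (intro primitive_mono) simp
  finally have "e * (t - 1) \<le> r" using r by simp
  then show False using e by (simp add: t_def)
qed

text \<open>The graph of the primitive at \<open>p = u s + v t\<close> lies below the line of slope \<open>a p\<close> through the value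
  at \<open>s\<close>, and the value at \<open>t\<close> lies above the line of slope \<open>a p\<close> through the value at \<open>p\<close>. As
  \<open>u (p - s) = v (t - p)\<close>, the two slope terms balance, even if \<open>a p = \<infinity>\<close>.\<close>

lemma primitive_convex_ordered:
  assumes a: "mono a" and pos: "\<And>l. 0 < l \<Longrightarrow> 0 < a l" and uv: "u + v = 1" and st: "s \<le> t"
  shows "primitive a (u * s + v * t) \<le> u * primitive a s + v * primitive a t"
proof (cases "u = 0 \<or> v = 0 \<or> s = t")
  case True
  then show ?thesis
    using uv by (auto simp: distrib_right[symmetric])
next
  case False
  then have "s < t" using st by auto
  show ?thesis
  proof (cases "t = \<infinity>")
    case True
    then show ?thesis using primitive_top[OF a pos] False by (simp add: ennreal_mult_eq_top_iff)
  next
    case t: False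
    have "u \<le> 1" "v \<le> 1" using uv by (metis le_iff_add add.commute)+
    then obtain u' v' where uv': "u = ennreal u'" "v = ennreal v'" "0 < u'" "0 < v'"
      using False by (cases u; cases v) (auto simp: top_unique)
    obtain s' t' where st': "s = ennreal s'" "t = ennreal t'" "0 \<le> s'" "s' < t'"
      using \<open>s < t\<close> t by (cases s; cases t) (auto simp: ennreal_less_iff)
    have one: "u' + v' = 1" using uv uv' by (simp add: ennreal_plus[symmetric] del: ennreal_plus)
    define p where "p = u' * s' + v' * t'"
    have pe: "u * s + v * t = ennreal p"
      using uv' st' by (simp add: p_def ennreal_mult[symmetric] ennreal_plus[symmetric] del: ennreal_plus)
    have ps: "p - s' = v' * (t' - s')" and tp: "t' - p = u' * (t' - s')"
      using one by (simp_all add: p_def algebra_simps) (metis distrib_left mult.commute mult.right_neutral add.commute)+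
    have p: "s' \<le> p" "p \<le> t'" using ps tp uv' st' by (smt (verit) mult_nonneg_nonneg)+
    have bal: "u' * (p - s') = v' * (t' - p)" unfolding ps tp by simp
    have "primitive a (ennreal p) = u * primitive a (ennreal p) + v * primitive a (ennreal p)"
      using uv by (simp add: distrib_right[symmetric])
    also have "\<dots> \<le> u * (primitive a s + a p * ennreal (p - s')) + v * primitive a (ennreal p)"
      using primitive_le_tangent[OF a st'(3) p(1)] unfolding st'(1)
      by (intro add_right_mono mult_left_mono) auto
    also have "\<dots> = u * primitive a s + (a p * ennreal (u' * (p - s')) + v * primitive a (ennreal p))"
      using uv' p by (simp add: ennreal_mult distrib_left mult_ac add_ac)
    also have "\<dots> = u * primitive a s + v * (primitive a (ennreal p) + a p * ennreal (t' - p))"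
      unfolding bal using uv' p by (simp add: ennreal_mult distrib_left mult_ac add_ac)
    also have "\<dots> \<le> u * primitive a s + v * primitive a t"
      using primitive_ge_tangent[OF a, of p t'] p st' unfolding st'(2)
      by (intro add_left_mono mult_left_mono) auto
    finally show ?thesis unfolding pe .
  qed
qed

lemma primitive_left_continuous:
  assumes [measurable]: "a \<in> borel_measurable borel"
  shows "continuous (at_left t) (primitive a)"
proof (cases "t = 0")
  case True
  then show ?thesis using trivial_limit_at_left_bot[where 'a=ennreal] by (simp add: bot_ennreal)
next
  case False
  have "(primitive a \<longlongrightarrow> primitive a t) (at_left t)"
  proof (rule tendsto_at_left_sequentially[of 0])
    show "0 < t" using False by (simp add: zero_less_iff_neq_zero)
  next
    fix S :: "nat \<Rightarrow> ennreal"
    assume S: "\<And>n. S n < t" "incseq S" "S \<longlonglongrightarrow> t"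
    show "(\<lambda>n. primitive a (S n)) \<longlonglongrightarrow> primitive a t"
      unfolding primitive_def
    proof (rule nn_integral_LIMSEQ)
      show "incseq (\<lambda>n l. a l * indicator {l. ennreal l < S n} l * indicator {0<..} l)"
        using incseqD[OF S(2)]
        by (intro monoI le_funI mult_right_mono mult_left_mono) (auto simp: indicator_def intro: less_le_trans)
    next
      fix l
      have "\<forall>\<^sub>F n in sequentially. ennreal l < S n \<longleftrightarrow> ennreal l < t"
      proof (cases "ennreal l < t")
        case True
        then show ?thesis using order_tendstoD(1)[OF S(3)] by simp
      next
        case False
        then have "\<not> ennreal l < S n" for n using S(1)[of n] by auto
        then show ?thesis using False by simp
      qed
      then have "\<forall>\<^sub>F n in sequentially. a l * indicator {l. ennreal l < S n} l * indicator {0<..} l =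
          a l * indicator {l. ennreal l < t} l * indicator {0<..} l"
        by eventually_elim (auto simp: indicator_def)
      then show "(\<lambda>n. a l * indicator {l. ennreal l < S n} l * indicator {0<..} l) \<longlonglongrightarrow>
          a l * indicator {l. ennreal l < t} l * indicator {0<..} l"
        by (rule tendsto_eventually)
    qed measurable
  qed
  then show ?thesis by (simp add: continuous_within)
qed

lemma young_function_primitive:
  assumes a: "mono a" and pos: "\<And>l. 0 < l \<Longrightarrow> 0 < a l"
    and fin: "0 < t0" "primitive a t0 < \<infinity>"
  shows "young_function (primitive a)"
proof -
  have conv: "primitive a (u * s + v * t) \<le> u * primitive a s + v * primitive a t" if "u + v = 1" for s t u v
  proof (cases "s \<le> t")
    case True then show ?thesis using that by (intro primitive_convex_ordered a pos) auto
  next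
    case False
    then show ?thesis using primitive_convex_ordered[OF a pos, of v u t s] that
      by (simp add: add.commute)
  qed
  have slope: "primitive a s / s \<le> primitive a t / t" if st: "0 < s" "s \<le> t" "t < \<infinity>" for s t
  proof -
    obtain s' t' where r: "s = ennreal s'" "t = ennreal t'" "0 < s'" "s' \<le> t'"
      using st by (cases s; cases t) (auto simp: top_unique)
    have "primitive a (ennreal (s' / t') * t + ennreal (1 - s' / t') * 0)
        \<le> ennreal (s' / t') * primitive a t + ennreal (1 - s' / t') * primitive a 0"
      using r by (intro conv) (simp add: ennreal_plus[symmetric] del: ennreal_plus)
    moreover have "ennreal (s' / t') * t = s" using r by (simp add: ennreal_mult[symmetric])
    ultimately have "primitive a s \<le> ennreal (s' / t') * primitive a t" by (simp add: primitive_0)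
    then have "primitive a s / s \<le> ennreal (s' / t') * primitive a t / s"
      by (rule divide_right_mono_ennreal)
    also have "\<dots> = (ennreal (s' / t') * inverse s) * primitive a t"
      by (simp add: divide_ennreal_def mult_ac)
    also have "ennreal (s' / t') * inverse s = inverse t"
      using r by (simp add: inverse_ennreal ennreal_mult[symmetric] inverse_eq_divide)
    finally show ?thesis by (simp add: divide_ennreal_def mult_ac)
  qed
  have "primitive a \<infinity> \<noteq> 0" using primitive_top[OF a pos] by simp
  then have "\<not> (\<forall>t>0. primitive a t = 0)"
    by (metis ennreal_zero_less_top infinity_ennreal_def)
  moreover have "\<not> (\<forall>t>0. primitive a t = \<infinity>)" using fin by auto
  ultimately show ?thesis
    unfolding young_function_def quasi_convex_def
    using conv slope primitive_0 primitive_left_continuous[OF borel_measurable_mono_ennreal[OF a]] by blast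
qed

section \<open>Distribution functions\<close>

lemma emeasure_unit_interval: "emeasure unit_interval {0<..<1} = 1"
  by (simp add: emeasure_restrict_space)

lemma space_unit_interval: "space unit_interval = {0<..<1}"
  by (simp add: space_restrict_space)

lemma distr_fun_le_1: "distr_fun f l \<le> 1"
  using emeasure_space[of unit_interval] by (simp add: distr_fun_def space_unit_interval emeasure_unit_interval)

lemma distr_fun_sets:
  fixes f :: "real \<Rightarrow> real"
  assumes [measurable]: "f \<in> borel_measurable unit_interval"
  shows "{x \<in> {0<..<1}. \<bar>f x\<bar> > l} \<in> sets unit_interval"
proof -
  have "{x \<in> space unit_interval. l < \<bar>f x\<bar>} \<in> sets unit_interval"
    using borel_measurable_abs[OF assms] by (simp add: borel_measurable_iff_greater)
  then show ?thesis by (simp add: space_unit_interval)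
qed

lemma antimono_distr_fun:
  assumes "f \<in> borel_measurable unit_interval"
  shows "antimono (distr_fun f)"
  unfolding distr_fun_def using assms by (intro antimonoI emeasure_mono distr_fun_sets) auto

lemma antimono_sharp_inverse_distr_fun:
  assumes "f \<in> borel_measurable unit_interval"
  shows "antimono (\<lambda>l. sharp_inverse E (distr_fun f l))"
  using antimono_distr_fun[OF assms] by (auto simp: antimono_def intro: sharp_inverse_mono)

lemma lambda_norm_cmult:
  assumes f: "f \<in> borel_measurable unit_interval" and c: "0 < c"
  shows "lambda_norm E (\<lambda>x. c * f x) = ennreal c * lambda_norm E f"
proof -
  have cf: "(\<lambda>x. c * f x) \<in> borel_measurable unit_interval" using f by measurable
  have [measurable]: "(\<lambda>l. sharp_inverse E (distr_fun (\<lambda>x. c * f x) l)) \<in> borel_measurable borel"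
    by (intro borel_measurable_antimono_ennreal antimono_sharp_inverse_distr_fun cf)
  have eq: "distr_fun (\<lambda>x. c * f x) (c * l) = distr_fun f l" for l
    using c by (simp add: distr_fun_def abs_mult)
  have "lambda_norm E (\<lambda>x. c * f x) = ennreal \<bar>c\<bar> *
    (\<integral>\<^sup>+l. sharp_inverse E (distr_fun (\<lambda>x. c * f x) (0 + c * l)) * indicator {0<..} (0 + c * l) \<partial>lborel)"
    unfolding lambda_norm_def using c by (intro nn_integral_real_affine) auto
  also have "\<dots> = ennreal c * lambda_norm E f"
    using c by (auto simp: lambda_norm_def eq zero_less_mult_iff indicator_def intro!: arg_cong2[of _ _ _ _ "(*)"] nn_integral_cong)
  finally show ?thesis .
qed

text \<open>Tonelli's theorem for the region \<open>{(l, x). l < \<bar>f x\<bar>}\<close>.\<close>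

lemma nn_integral_primitive:
  assumes [measurable]: "a \<in> borel_measurable borel" and f[measurable]: "f \<in> borel_measurable unit_interval"
  shows "(\<integral>\<^sup>+x. primitive a (ennreal \<bar>f x\<bar>) \<partial>unit_interval) = (\<integral>\<^sup>+l\<in>{0<..}. a l * distr_fun f l \<partial>lborel)"
proof -
  interpret U: finite_measure unit_interval
    by (intro finite_measureI) (simp add: space_unit_interval emeasure_unit_interval)
  interpret pair_sigma_finite lborel unit_interval
    by (intro pair_sigma_finite.intro) unfold_locales
  define W where "W = {z \<in> space (lborel \<Otimes>\<^sub>M unit_interval). fst z < \<bar>f (snd z)\<bar>}"
  have [measurable]: "(\<lambda>z. f (snd z)) \<in> borel_measurable (lborel \<Otimes>\<^sub>M unit_interval)"
    by (rule measurable_compose[OF measurable_snd f])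
  have [measurable]: "W \<in> sets (lborel \<Otimes>\<^sub>M unit_interval)"
    unfolding W_def by (intro borel_measurable_less borel_measurable_abs) auto
  have "(\<integral>\<^sup>+x. primitive a (ennreal \<bar>f x\<bar>) \<partial>unit_interval) =
     (\<integral>\<^sup>+x. (\<integral>\<^sup>+l. a l * indicator {0<..} l * indicator W (l, x) \<partial>lborel) \<partial>unit_interval)"
    unfolding primitive_def
    by (intro nn_integral_cong) (auto simp: indicator_def W_def space_pair_measure ennreal_less_iff)
  also have "\<dots> = (\<integral>\<^sup>+l. (\<integral>\<^sup>+x. a l * indicator {0<..} l * indicator W (l, x) \<partial>unit_interval) \<partial>lborel)"
    by (rule Fubini') (simp add: case_prod_unfold)
  also have "\<dots> = (\<integral>\<^sup>+l\<in>{0<..}. a l * distr_fun f l \<partial>lborel)"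
  proof (rule nn_integral_cong)
    fix l :: real
    have "(\<integral>\<^sup>+x. a l * indicator {0<..} l * indicator W (l, x) \<partial>unit_interval) =
       (\<integral>\<^sup>+x. a l * indicator {0<..} l * indicator {x \<in> {0<..<1}. \<bar>f x\<bar> > l} x \<partial>unit_interval)"
      by (intro nn_integral_cong) (auto simp: indicator_def W_def space_pair_measure space_unit_interval)
    also have "\<dots> = a l * indicator {0<..} l * distr_fun f l"
      unfolding distr_fun_def by (intro nn_integral_cmult_indicator distr_fun_sets f)
    finally show "(\<integral>\<^sup>+x. a l * indicator {0<..} l * indicator W (l, x) \<partial>unit_interval) =
      a l * distr_fun f l * indicator {0<..} l" by (simp add: mult_ac)
  qed
  finally show ?thesis .
qed

section \<open>Luxemburg norm and modular\<close>

text \<open>By star-shapedness, \<open>A (t / r) \<le> A t / r\<close> for \<open>r \<ge> 1\<close>, so every \<open>r \<ge> 1\<close> above the value of the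
  integral is admissible.\<close>

lemma orlicz_norm_finite:
  assumes A: "quasi_convex A" and I: "(\<integral>\<^sup>+x. A (ennreal \<bar>f x\<bar>) \<partial>unit_interval) < \<infinity>"
    and [measurable]: "(\<lambda>x. A (ennreal \<bar>f x\<bar>)) \<in> borel_measurable unit_interval"
  shows "orlicz_norm A f < \<infinity>"
proof -
  obtain i where i: "(\<integral>\<^sup>+x. A (ennreal \<bar>f x\<bar>) \<partial>unit_interval) = ennreal i" "0 \<le> i"
    using I by (cases "\<integral>\<^sup>+x. A (ennreal \<bar>f x\<bar>) \<partial>unit_interval") auto
  define r where "r = i + 1"
  have r: "r \<ge> 1" "i \<le> r" using i by (auto simp: r_def)
  have "(\<integral>\<^sup>+x. A (ennreal \<bar>f x\<bar> / ennreal r) \<partial>unit_interval) \<le> (\<integral>\<^sup>+x. ennreal (1 / r) * A (ennreal \<bar>f x\<bar>) \<partial>unit_interval)"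
  proof (rule nn_integral_mono)
    fix x
    have "ennreal \<bar>f x\<bar> / ennreal r = ennreal (1 / r) * ennreal \<bar>f x\<bar>"
      using r by (simp add: divide_ennreal ennreal_mult[symmetric])
    then show "A (ennreal \<bar>f x\<bar> / ennreal r) \<le> ennreal (1 / r) * A (ennreal \<bar>f x\<bar>)"
      using r quasi_convex_star_shaped[OF A, of "1 / r" "ennreal \<bar>f x\<bar>"] by simp
  qed
  also have "\<dots> = ennreal (1 / r) * ennreal i" by (simp add: nn_integral_cmult i)
  also have "\<dots> \<le> 1" using r i by (simp add: ennreal_mult[symmetric] divide_le_eq_1)
  finally have "orlicz_norm A f \<le> ennreal r"
    unfolding orlicz_norm_def using r by (intro Inf_lower) auto
  then show ?thesis by (auto simp: le_less_trans)
qed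

text \<open>For a merely monotone \<open>A\<close> the infimum in the Luxemburg norm need not be attained;
  halving \<open>f\<close> leaves enough room to use an admissible \<open>r < 2\<close>.\<close>

lemma orlicz_modular_half_le_1:
  assumes A: "\<And>s t. s \<le> t \<Longrightarrow> A s \<le> A t" and f: "orlicz_norm A f \<le> 1"
  shows "(\<integral>\<^sup>+x. A (ennreal \<bar>f x / 2\<bar>) \<partial>unit_interval) \<le> 1"
proof -
  have "orlicz_norm A f < 2" using f by (rule le_less_trans) simp
  then obtain r where r: "0 < r" "r < 2" "(\<integral>\<^sup>+x. A (ennreal \<bar>f x\<bar> / r) \<partial>unit_interval) \<le> 1"
    unfolding orlicz_norm_def Inf_less_iff by auto
  have "ennreal \<bar>f x / 2\<bar> \<le> ennreal \<bar>f x\<bar> / r" for x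
  proof -
    have "ennreal \<bar>f x / 2\<bar> = ennreal \<bar>f x\<bar> * inverse 2"
      by (simp add: abs_mult divide_ennreal_def[symmetric] ennreal_divide_numeral)
    also have "\<dots> \<le> ennreal \<bar>f x\<bar> * inverse r"
      using r by (intro mult_left_mono ennreal_inverse_antimono) auto
    finally show ?thesis by (simp add: divide_ennreal_def)
  qed
  then have "(\<integral>\<^sup>+x. A (ennreal \<bar>f x / 2\<bar>) \<partial>unit_interval) \<le> (\<integral>\<^sup>+x. A (ennreal \<bar>f x\<bar> / r) \<partial>unit_interval)"
    by (intro nn_integral_mono A)
  then show ?thesis using r by auto
qed

section \<open>Slopes of the fundamental function\<close>

text \<open>The value \<open>\<infinity>\<close> at \<open>m = 0\<close> keeps the slope decreasing in \<open>m\<close>; along a distribution function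
  \<open>m\<close> it makes the primitive infinite beyond the levels at which \<open>m\<close> is positive.\<close>

definition slope_at :: "(ennreal \<Rightarrow> ennreal) \<Rightarrow> ennreal \<Rightarrow> ennreal" where
  "slope_at P m = (if m = 0 then \<infinity> else P m / m)"

lemma slope_at_mult_le: "m < \<infinity> \<Longrightarrow> slope_at P m * m \<le> P m"
  by (auto simp: slope_at_def ennreal_divide_times zero_less_iff_neq_zero)

lemma slope_at_sharp_inverse_antimono:
  assumes E: "quasi_convex E" "finite_valued E" and st: "s \<le> t" "t < \<infinity>"
  shows "slope_at (sharp_inverse E) t \<le> slope_at (sharp_inverse E) s"
proof (cases "s = 0")
  case True
  then show ?thesis by (simp add: slope_at_def)
next
  case False
  then obtain s' t' where r: "s = ennreal s'" "t = ennreal t'" "0 < s'" "s' \<le> t'"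
    using st by (cases s; cases t) (auto simp: top_unique)
  obtain x where x: "sharp_inverse E t = ennreal x" "0 \<le> x"
    using sharp_inverse_less_top[OF E st(2)] by (cases "sharp_inverse E t") auto
  obtain y where y: "sharp_inverse E s = ennreal y" "0 \<le> y"
    using sharp_inverse_less_top[OF E, of s] r by (cases "sharp_inverse E s") auto
  have "s' * x \<le> t' * y"
    using sharp_inverse_quasi_concave[OF E r(3,4)] r x y by (simp add: ennreal_mult[symmetric])
  then have "x / t' \<le> y / s'" using r by (simp add: field_simps)
  then show ?thesis using r x y by (simp add: slope_at_def divide_ennreal)
qed

lemma slope_at_sharp_inverse_pos:
  assumes E: "quasi_convex E" "finite_valued E" and m: "m < \<infinity>"
  shows "0 < slope_at (sharp_inverse E) m"
proof (cases "m = 0")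
  case False
  then obtain r where "m = ennreal r" "0 < r" using m by (cases m) auto
  then show ?thesis using sharp_inverse_pos[OF E, of r]
    by (simp add: slope_at_def ennreal_zero_less_divide)
qed (simp add: slope_at_def)

text \<open>Compare \<open>\<gamma>\<close> with \<open>K m\<close>, where \<open>K = (2 q)\<^sup>n\<close>, and use \<open>P (K m) \<le> q\<^sup>n P m\<close>. If \<open>\<gamma> \<le> K m\<close>, the
  first summand dominates. Otherwise \<open>P \<gamma> / \<gamma> \<le> P (K m) / (K m) \<le> 2\<^sup>-\<^sup>n P m / m\<close>, since
  \<open>q\<^sup>n / K = 2\<^sup>-\<^sup>n\<close>.\<close>

lemma nabla2_interpolation:
  assumes E: "quasi_convex E" "finite_valued E" "nabla2_near_infinity E"
  obtains q d :: real where "q \<ge> 1" "d > 0"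
    "\<And>n m \<gamma>. ennreal ((2 * q) ^ n) * m \<le> ennreal d \<Longrightarrow> \<gamma> < \<infinity> \<Longrightarrow>
      sharp_inverse E \<gamma> \<le> ennreal (q ^ n) * sharp_inverse E m +
        ennreal (1 / 2 ^ n) * (slope_at (sharp_inverse E) m * \<gamma>)"
proof -
  obtain q d :: real where q: "q \<ge> 1" "d > 0" and
    Q: "\<And>n t. 0 < t \<Longrightarrow> (2 * q) ^ n * t \<le> d \<Longrightarrow>
       sharp_inverse E (ennreal ((2 * q) ^ n * t)) \<le> ennreal (q ^ n) * sharp_inverse E (ennreal t)"
    using nabla2_sharp_inverse[OF E] by metis
  have "sharp_inverse E \<gamma> \<le> ennreal (q ^ n) * sharp_inverse E m +
        ennreal (1 / 2 ^ n) * (slope_at (sharp_inverse E) m * \<gamma>)"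
    if small: "ennreal ((2 * q) ^ n) * m \<le> ennreal d" and \<gamma>: "\<gamma> < \<infinity>" for n m \<gamma>
  proof (cases "m = 0 \<or> \<gamma> = 0")
    case True
    then show ?thesis
      by (cases "\<gamma> = 0") (auto simp: sharp_inverse_0 slope_at_def ennreal_top_mult ennreal_mult_top)
  next
    case False
    define K where "K = (2 * q) ^ n"
    have K: "K > 0" using q by (simp add: K_def)
    have "m \<noteq> \<infinity>" using small K unfolding K_def[symmetric] by (auto simp: ennreal_mult_top top_unique)
    then obtain m' g where r: "m = ennreal m'" "\<gamma> = ennreal g" "0 < m'" "0 < g"
      using False \<gamma> by (cases m; cases \<gamma>) auto
    have Km: "K * m' \<le> d" using small K r q unfolding K_def[symmetric] by (simp add: ennreal_mult[symmetric])
    have step: "sharp_inverse E (ennreal (K * m')) \<le> ennreal (q ^ n) * sharp_inverse E m"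
      using Q[OF r(3), of n] Km by (simp add: K_def r)
    show ?thesis
    proof (cases "g \<le> K * m'")
      case True
      then have "sharp_inverse E \<gamma> \<le> sharp_inverse E (ennreal (K * m'))"
        unfolding r by (intro sharp_inverse_mono ennreal_leI)
      with step have "sharp_inverse E \<gamma> \<le> ennreal (q ^ n) * sharp_inverse E m" by (rule order_trans[rotated])
      then show ?thesis by (simp add: add_increasing2)
    next
      case False
      obtain x where x: "sharp_inverse E \<gamma> = ennreal x" "0 \<le> x"
        using sharp_inverse_less_top[OF E(1,2) \<gamma>] by (cases "sharp_inverse E \<gamma>") auto
      obtain y where y: "sharp_inverse E m = ennreal y" "0 \<le> y"
        using sharp_inverse_less_top[OF E(1,2), of m] r by (cases "sharp_inverse E m") auto
      have "ennreal (K * m') * ennreal x \<le> ennreal g * sharp_inverse E (ennreal (K * m'))"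
        using sharp_inverse_quasi_concave[OF E(1,2), of "K * m'" g] False K r x by simp
      also have "\<dots> \<le> ennreal g * (ennreal (q ^ n) * ennreal y)"
        using step y by (intro mult_left_mono) auto
      finally have "(K * m') * x \<le> g * (q ^ n * y)"
        using K r x y q by (simp add: ennreal_mult[symmetric])
      then have "q ^ n * (2 ^ n * m' * x) \<le> q ^ n * (g * y)"
        by (simp add: K_def power_mult_distrib mult_ac)
      then have "2 ^ n * m' * x \<le> g * y" using q by (subst (asm) mult_le_cancel_left_pos) auto
      then have "x \<le> 1 / 2 ^ n * (y / m' * g)" using r by (simp add: field_simps)
      then have "sharp_inverse E \<gamma> \<le> ennreal (1 / 2 ^ n) * (slope_at (sharp_inverse E) m * \<gamma>)"
        using r x y by (simp add: slope_at_def divide_ennreal ennreal_mult[symmetric] ennreal_leI)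
      then show ?thesis by (simp add: add_increasing)
    qed
  qed
  then show ?thesis using that[of q d] q by blast
qed

section \<open>Almost-compactness of the embedding\<close>

lemma nn_integral_tail_small:
  assumes [measurable]: "h \<in> borel_measurable borel" and fin: "(\<integral>\<^sup>+l\<in>{0<..}. h l \<partial>lborel) < \<infinity>" and e: "0 < (e::ennreal)"
  obtains N :: nat where "(\<integral>\<^sup>+l\<in>{real N<..}. h l \<partial>lborel) < e"
proof -
  have "(\<lambda>N. \<integral>\<^sup>+l. h l * indicator {real N<..} l \<partial>lborel) \<longlonglongrightarrow> (\<integral>\<^sup>+l. 0 \<partial>(lborel::real measure))"
  proof (rule nn_integral_dominated_convergence[where w = "\<lambda>l. h l * indicator {0<..} l"])
    show "AE l in lborel. h l * indicator {real N<..} l \<le> h l * indicator {0<..} l" for N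
      by (auto simp: indicator_def)
    show "AE l in lborel. (\<lambda>N. h l * indicator {real N<..} l) \<longlonglongrightarrow> 0"
    proof (intro AE_I2 tendsto_eventually)
      fix l :: real
      show "\<forall>\<^sub>F N in sequentially. h l * indicator {real N<..} l = 0"
        using eventually_ge_at_top[of "nat \<lceil>l\<rceil>"]
        by eventually_elim (auto simp: indicator_def)
    qed
  qed (use fin in auto)
  then have "\<forall>\<^sub>F N in sequentially. (\<integral>\<^sup>+l. h l * indicator {real N<..} l \<partial>lborel) < e"
    using e by (intro order_tendstoD(2)) auto
  then show ?thesis using that by (auto simp: eventually_sequentially)
qed

lemma emeasure_tendsto_0:
  assumes S: "\<And>n::nat. S n \<in> sets unit_interval"
    and lim: "AE x in unit_interval. (\<lambda>n. indicator (S n) x :: real) \<longlonglongrightarrow> 0"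
  shows "(\<lambda>n. emeasure unit_interval (S n)) \<longlonglongrightarrow> 0"
proof -
  have "(\<lambda>n. \<integral>\<^sup>+x. indicator (S n) x \<partial>unit_interval) \<longlonglongrightarrow> (\<integral>\<^sup>+x. 0 \<partial>unit_interval)"
  proof (rule nn_integral_dominated_convergence[where w = "\<lambda>_. 1"])
    show "(\<integral>\<^sup>+x. 1 \<partial>unit_interval) < \<infinity>" by (simp add: space_unit_interval emeasure_unit_interval)
    show "AE x in unit_interval. (\<lambda>n. indicator (S n) x :: ennreal) \<longlonglongrightarrow> 0"
      using lim
    proof eventually_elim
      case (elim x)
      have "(\<lambda>n. ennreal (indicator (S n) x)) \<longlonglongrightarrow> ennreal 0" using elim by (rule tendsto_ennrealI)
      then show ?case by (simp add: ennreal_indicator)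
    qed
  qed (use S in \<open>auto simp: indicator_def\<close>)
  then show ?thesis using S by simp
qed

lemma distr_fun_restrict_le:
  assumes f: "f \<in> borel_measurable unit_interval" and S: "S \<in> sets unit_interval" and l: "0 \<le> l"
  shows "distr_fun (\<lambda>x. f x * indicator S x) l \<le> distr_fun f l"
    and "distr_fun (\<lambda>x. f x * indicator S x) l \<le> emeasure unit_interval S"
  unfolding distr_fun_def using f S l
  by (intro emeasure_mono distr_fun_sets; auto simp: indicator_def split: if_splits)+

text \<open>The claim \<open>key\<close> bounds the norm of \<open>g \<chi>\<^sub>S\<close> uniformly over the modular unit ball, by splitting the
  integral over \<open>l\<close> at a level \<open>N\<close> that depends neither on \<open>g\<close> nor on \<open>S\<close>.\<close>

lemma almost_compact_embedding_primitive:
  assumes E: "quasi_convex E" "finite_valued E" "nabla2_near_infinity E"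
    and m: "antimono m" "\<And>l. m l \<le> 1"
    and fin: "(\<integral>\<^sup>+l\<in>{0<..}. sharp_inverse E (m l) \<partial>lborel) < \<infinity>"
  shows "almost_compact_embedding (orlicz_norm (primitive (\<lambda>l. slope_at (sharp_inverse E) (m l)))) (lambda_norm E)"
proof -
  let ?P = "sharp_inverse E"
  define a where "a = (\<lambda>l. slope_at ?P (m l))"
  have mtop: "m l < \<infinity>" for l using m(2)[of l] by (auto simp: le_less_trans)
  have a: "mono a"
    unfolding a_def using m(1) mtop by (intro monoI slope_at_sharp_inverse_antimono E) (auto simp: antimono_def)
  have am[measurable]: "a \<in> borel_measurable borel" by (rule borel_measurable_mono_ennreal[OF a])
  have Pm[measurable]: "(\<lambda>l. ?P (m l)) \<in> borel_measurable borel"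
    using m(1) by (intro borel_measurable_antimono_ennreal) (auto simp: antimono_def intro: sharp_inverse_mono)
  obtain q d :: real where q: "q \<ge> 1" "d > 0" and
    Q: "\<And>n m \<gamma>. ennreal ((2 * q) ^ n) * m \<le> ennreal d \<Longrightarrow> \<gamma> < \<infinity> \<Longrightarrow>
      ?P \<gamma> \<le> ennreal (q ^ n) * ?P m + ennreal (1 / 2 ^ n) * (slope_at ?P m * \<gamma>)"
    using nabla2_interpolation[OF E] by metis
  have key: "\<exists>N::nat. \<forall>g S. g \<in> borel_measurable unit_interval \<longrightarrow> S \<in> sets unit_interval \<longrightarrow>
      (\<integral>\<^sup>+x. primitive a (ennreal \<bar>g x\<bar>) \<partial>unit_interval) \<le> 1 \<longrightarrow>
      lambda_norm E (\<lambda>x. g x * indicator S x) \<le> ennreal N * ?P (emeasure unit_interval S) + ennreal (2 * e)"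
    if e: "0 < e" for e :: real
  proof -
    obtain n where n: "1 / 2 ^ n < e"
      using real_arch_pow_inv[OF e, of "1/2"] by (auto simp: power_one_over)
    define K where "K = (2 * q) ^ n"
    have K: "K > 0" using q by (simp add: K_def)
    \<comment> \<open>The first entry makes the tail of \<open>q\<^sup>n P m\<close> small, the second forces \<open>K m l \<le> d\<close> beyond
      level \<open>N\<close>, as \<open>P (m l)\<close> is at most the integral of \<open>P m\<close> over the unit interval before \<open>N\<close>.\<close>
    define h where "h = min (ennreal (e / q ^ n)) (?P (ennreal (d / K)))"
    have "0 < h" unfolding h_def using e q K sharp_inverse_pos[OF E(1,2), of "d / K"] by simp
    then obtain N' where N': "(\<integral>\<^sup>+l\<in>{real N'<..}. ?P (m l) \<partial>lborel) < h"
      using nn_integral_tail_small[OF Pm fin] by metis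
    define N where "N = N' + 1"
    have small: "ennreal K * m l \<le> ennreal d" if l: "real N < l" for l
    proof (rule ccontr)
      assume "\<not> ?thesis"
      then have less: "ennreal d < ennreal K * m l" by simp
      have "ennreal (d / K) \<le> m l"
      proof (rule ccontr)
        assume "\<not> ?thesis"
        then have "ennreal K * m l \<le> ennreal K * ennreal (d / K)" by (intro mult_left_mono) auto
        also have "\<dots> = ennreal d" using K q by (simp add: ennreal_mult[symmetric])
        finally show False using less by simp
      qed
      then have "?P (ennreal (d / K)) \<le> ?P (m l)" by (rule sharp_inverse_mono)
      also have "\<dots> = (\<integral>\<^sup>+x. ?P (m l) * indicator {real N'<..<real N} x \<partial>lborel)"
        by (simp add: nn_integral_cmult_indicator N_def)
      also have "\<dots> \<le> (\<integral>\<^sup>+x\<in>{real N'<..}. ?P (m x) \<partial>lborel)"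
        using l m(1) by (intro nn_integral_mono) (auto simp: indicator_def antimono_def intro!: sharp_inverse_mono)
      also have "\<dots> < ?P (ennreal (d / K))" using N' by (simp add: h_def)
      finally show False by simp
    qed
    have tail: "ennreal (q ^ n) * (\<integral>\<^sup>+l\<in>{real N<..}. ?P (m l) \<partial>lborel) \<le> ennreal e"
    proof -
      have "(\<integral>\<^sup>+l\<in>{real N<..}. ?P (m l) \<partial>lborel) \<le> (\<integral>\<^sup>+l\<in>{real N'<..}. ?P (m l) \<partial>lborel)"
        by (intro nn_integral_mono) (auto simp: indicator_def N_def)
      also have "\<dots> \<le> ennreal (e / q ^ n)" using N' by (simp add: h_def less_imp_le)
      finally have "ennreal (q ^ n) * (\<integral>\<^sup>+l\<in>{real N<..}. ?P (m l) \<partial>lborel) \<le> ennreal (q ^ n) * ennreal (e / q ^ n)"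
        by (rule mult_left_mono) simp
      also have "\<dots> = ennreal e" using q e by (simp add: ennreal_mult[symmetric])
      finally show ?thesis .
    qed
    show ?thesis
    proof (intro exI[of _ N] allI impI)
      fix g S
      assume g: "g \<in> borel_measurable unit_interval" and S: "S \<in> sets unit_interval"
        and mod: "(\<integral>\<^sup>+x. primitive a (ennreal \<bar>g x\<bar>) \<partial>unit_interval) \<le> 1"
      let ?gS = "\<lambda>x. g x * indicator S x"
      let ?s = "?P (emeasure unit_interval S)"
      have [measurable]: "distr_fun g \<in> borel_measurable borel"
        by (intro borel_measurable_antimono_ennreal antimono_distr_fun g)
      have pw: "?P (distr_fun ?gS l) * indicator {0<..} l \<le> ?s * indicator {0<..real N} l
          + ennreal (q ^ n) * (?P (m l) * indicator {real N<..} l)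
          + ennreal (1 / 2 ^ n) * (a l * distr_fun g l * indicator {0<..} l)" for l
      proof -
        consider "l \<le> 0" | "0 < l" "l \<le> real N" | "real N < l" "0 < l" by linarith
        then show ?thesis
        proof cases
          case 2
          have "?P (distr_fun ?gS l) \<le> ?s"
            using 2 by (intro sharp_inverse_mono distr_fun_restrict_le g S) auto
          then show ?thesis using 2 by (simp add: add_increasing2)
        next
          case 3
          have "?P (distr_fun ?gS l) \<le> ?P (distr_fun g l)"
            using 3 by (intro sharp_inverse_mono distr_fun_restrict_le g S) auto
          also have "\<dots> \<le> ennreal (q ^ n) * ?P (m l) + ennreal (1 / 2 ^ n) * (a l * distr_fun g l)"
            unfolding a_def using small[OF 3(1)] distr_fun_le_1[of g l]
            by (intro Q) (auto simp: K_def le_less_trans)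
          finally show ?thesis using 3 by simp
        qed simp
      qed
      have "lambda_norm E ?gS \<le> (\<integral>\<^sup>+l. ?s * indicator {0<..real N} l
          + ennreal (q ^ n) * (?P (m l) * indicator {real N<..} l)
          + ennreal (1 / 2 ^ n) * (a l * distr_fun g l * indicator {0<..} l) \<partial>lborel)"
        unfolding lambda_norm_def by (intro nn_integral_mono pw)
      also have "\<dots> = ?s * ennreal (real N) + ennreal (q ^ n) * (\<integral>\<^sup>+l\<in>{real N<..}. ?P (m l) \<partial>lborel)
          + ennreal (1 / 2 ^ n) * (\<integral>\<^sup>+l\<in>{0<..}. a l * distr_fun g l \<partial>lborel)"
        by (simp add: nn_integral_add nn_integral_cmult nn_integral_cmult_indicator)
      also have "\<dots> \<le> ?s * ennreal (real N) + ennreal e + ennreal e * 1"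
        using tail mod n unfolding nn_integral_primitive[OF am g]
        by (intro add_mono mult_mono ennreal_leI) auto
      also have "\<dots> = ennreal (real N) * ?s + ennreal (2 * e)"
        using e by (simp add: mult.commute add.assoc ennreal_plus[symmetric] del: ennreal_plus)
      finally show "lambda_norm E ?gS \<le> ennreal N * ?s + ennreal (2 * e)" by simp
    qed
  qed
  show ?thesis
    unfolding almost_compact_embedding_def a_def[symmetric]
  proof (intro allI impI)
    fix S :: "nat \<Rightarrow> real set"
    assume "\<forall>n. S n \<in> sets unit_interval"
      and lim: "AE x in unit_interval. (\<lambda>n. indicator (S n) x :: real) \<longlonglongrightarrow> 0"
    then have S: "S n \<in> sets unit_interval" for n by simp
    note S0 = emeasure_tendsto_0[OF S lim]
    let ?F = "\<lambda>n. SUP f \<in> {f \<in> borel_measurable unit_interval. orlicz_norm (primitive a) f \<le> 1}.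
                lambda_norm E (\<lambda>x. f x * indicator (S n) x)"
    show "?F \<longlonglongrightarrow> 0"
    proof (rule order_tendstoI)
      fix y :: ennreal assume y: "0 < y"
      obtain y' where y': "0 < y'" "ennreal y' \<le> y"
      proof (cases y)
        case (real x) then show ?thesis using that[of x] y by auto
      next
        case top then show ?thesis using that[of 1] by auto
      qed
      \<comment> \<open>The three error terms add up to at most \<open>3 e\<close>, doubled by the rescaling \<open>f = 2 g\<close>.\<close>
      define e where "e = y' / 8"
      have e: "0 < e" using y' by (simp add: e_def)
      obtain N :: nat where N: "\<And>g S. g \<in> borel_measurable unit_interval \<Longrightarrow> S \<in> sets unit_interval \<Longrightarrow>
        (\<integral>\<^sup>+x. primitive a (ennreal \<bar>g x\<bar>) \<partial>unit_interval) \<le> 1 \<Longrightarrow>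
        lambda_norm E (\<lambda>x. g x * indicator S x) \<le> ennreal N * ?P (emeasure unit_interval S) + ennreal (2 * e)"
        using key[OF e] by blast
      obtain d' where d': "0 < d'" "?P (ennreal d') \<le> ennreal (e / (N + 1))"
        using sharp_inverse_small_near_0[OF E(1,2), of "e / (N + 1)"] e by auto
      have "\<forall>\<^sub>F n in sequentially. emeasure unit_interval (S n) < ennreal d'"
        using d' by (intro order_tendstoD(2)[OF S0]) auto
      then show "\<forall>\<^sub>F n in sequentially. ?F n < y"
      proof eventually_elim
        case (elim n)
        have PS: "ennreal N * ?P (emeasure unit_interval (S n)) \<le> ennreal e"
        proof -
          have "?P (emeasure unit_interval (S n)) \<le> ?P (ennreal d')"
            using elim by (intro sharp_inverse_mono) simp
          also note d'(2)
          finally have "ennreal N * ?P (emeasure unit_interval (S n)) \<le> ennreal N * ennreal (e / (N + 1))"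
            by (rule mult_left_mono) simp
          also have "\<dots> = ennreal (N * (e / (N + 1)))"
            using e by (intro ennreal_mult[symmetric]) auto
          also have "\<dots> \<le> ennreal e" using e by (intro ennreal_leI) (simp add: field_simps)
          finally show ?thesis .
        qed
        have "?F n \<le> ennreal (6 * e)"
        proof (rule SUP_least)
          fix f assume "f \<in> {f \<in> borel_measurable unit_interval. orlicz_norm (primitive a) f \<le> 1}"
          then have f: "f \<in> borel_measurable unit_interval" "orlicz_norm (primitive a) f \<le> 1" by auto
          define g where "g = (\<lambda>x. f x / 2)"
          have g: "g \<in> borel_measurable unit_interval" unfolding g_def using f by measurable
          have gS: "(\<lambda>x. g x * indicator (S n) x) \<in> borel_measurable unit_interval"
            using S by (intro borel_measurable_times g) auto
          have "lambda_norm E (\<lambda>x. f x * indicator (S n) x) = lambda_norm E (\<lambda>x. 2 * (g x * indicator (S n) x))"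
            by (simp add: g_def)
          also have "\<dots> = ennreal 2 * lambda_norm E (\<lambda>x. g x * indicator (S n) x)"
            by (intro lambda_norm_cmult gS) simp
          also have "\<dots> \<le> ennreal 2 * (ennreal N * ?P (emeasure unit_interval (S n)) + ennreal (2 * e))"
            using orlicz_modular_half_le_1[OF primitive_mono f(2)]
            by (intro mult_left_mono N g S) (auto simp: g_def)
          also have "\<dots> \<le> ennreal 2 * (ennreal e + ennreal (2 * e))"
            by (intro mult_left_mono add_right_mono PS) simp
          also have "\<dots> = ennreal (6 * e)"
            using e by (simp add: ennreal_plus[symmetric] numeral_mult_ennreal del: ennreal_plus)
          finally show "lambda_norm E (\<lambda>x. f x * indicator (S n) x) \<le> ennreal (6 * e)" .
        qed
        also have "\<dots> < ennreal y'" using y' by (intro ennreal_lessI) (auto simp: e_def)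
        also have "\<dots> \<le> y" by fact
        finally show ?case .
      qed
    qed simp
  qed
qed

section \<open>The two inclusions\<close>

text \<open>The function \<open>m\<close> equals \<open>1\<close> on \<open>(0,1)\<close> so that its slope is finite there; otherwise the primitive
  would be infinite on \<open>(0,\<infinity>]\<close> when \<open>f\<close> vanishes almost everywhere.\<close>

lemma lambda_space_sub_diagonal:
  assumes E: "quasi_convex E" "finite_valued E" "nabla2_near_infinity E" and f: "f \<in> lambda_space E"
  obtains A where "young_function A" "almost_compact_embedding (orlicz_norm A) (lambda_norm E)" "f \<in> orlicz_space A"
proof -
  let ?P = "sharp_inverse E"
  have fm[measurable]: "f \<in> borel_measurable unit_interval" and fl: "lambda_norm E f < \<infinity>"
    using f by (auto simp: lambda_space_def)
  define m where "m l = (if l < 1 then 1 else distr_fun f l)" for l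
  define a where "a = (\<lambda>l. slope_at ?P (m l))"
  have m: "antimono m" "\<And>l. m l \<le> 1"
    using antimono_distr_fun[OF fm] by (auto simp: m_def antimono_def distr_fun_le_1)
  have fin1: "?P 1 < \<infinity>" by (intro sharp_inverse_less_top E) simp
  have Pf[measurable]: "(\<lambda>l. ?P (distr_fun f l)) \<in> borel_measurable borel"
    by (intro borel_measurable_antimono_ennreal antimono_sharp_inverse_distr_fun fm)
  have fin: "(\<integral>\<^sup>+l\<in>{0<..}. ?P (m l) \<partial>lborel) < \<infinity>"
  proof -
    have "(\<integral>\<^sup>+l\<in>{0<..}. ?P (m l) \<partial>lborel)
        \<le> (\<integral>\<^sup>+l. ?P 1 * indicator {0<..<1} l + ?P (distr_fun f l) * indicator {0<..} l \<partial>lborel)"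
      by (intro nn_integral_mono) (auto simp: indicator_def m_def)
    also have "\<dots> = ?P 1 + lambda_norm E f"
      by (simp add: nn_integral_add nn_integral_cmult_indicator lambda_norm_def)
    also have "\<dots> < \<infinity>" using fin1 fl by simp
    finally show ?thesis .
  qed
  have mtop: "m l < \<infinity>" for l using m(2)[of l] by (auto simp: le_less_trans)
  have a: "mono a"
    unfolding a_def using m(1) mtop by (intro monoI slope_at_sharp_inverse_antimono E) (auto simp: antimono_def)
  have am[measurable]: "a \<in> borel_measurable borel" by (rule borel_measurable_mono_ennreal[OF a])
  have bound: "a l * indicator {0<..<1} l \<le> ?P 1 * indicator {0<..<1} l" for l
    by (auto simp: indicator_def a_def m_def slope_at_def divide_ennreal_def)
  have "primitive a (ennreal 1) \<le> (\<integral>\<^sup>+l. ?P 1 * indicator {0<..<1::real} l \<partial>lborel)"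
    unfolding primitive_ennreal[OF zero_le_one] by (intro nn_integral_mono bound)
  also have "\<dots> = ?P 1" by (simp add: nn_integral_cmult_indicator)
  finally have "primitive a 1 < \<infinity>" using fin1 by (simp add: le_less_trans)
  then have Y: "young_function (primitive a)"
    using slope_at_sharp_inverse_pos[OF E(1,2) mtop]
    by (intro young_function_primitive[of _ 1] a) (auto simp: a_def)
  have "a l * distr_fun f l \<le> ?P (m l)" for l
  proof -
    have "a l * distr_fun f l \<le> a l * m l"
      by (intro mult_left_mono) (auto simp: m_def distr_fun_le_1)
    also have "\<dots> \<le> ?P (m l)" unfolding a_def by (intro slope_at_mult_le mtop)
    finally show ?thesis .
  qed
  then have "(\<integral>\<^sup>+x. primitive a (ennreal \<bar>f x\<bar>) \<partial>unit_interval) \<le> (\<integral>\<^sup>+l\<in>{0<..}. ?P (m l) \<partial>lborel)"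
    unfolding nn_integral_primitive[OF am fm] by (intro nn_integral_mono mult_right_mono) auto
  then have "orlicz_norm (primitive a) f < \<infinity>"
    using Y fin
  proof (intro orlicz_norm_finite)
    have "mono (\<lambda>t. primitive a (ennreal t))" by (intro monoI primitive_mono ennreal_leI)
    from borel_measurable_mono_ennreal[OF this]
    show "(\<lambda>x. primitive a (ennreal \<bar>f x\<bar>)) \<in> borel_measurable unit_interval"
      by (rule measurable_compose[rotated]) simp
  qed (auto simp: young_function_def le_less_trans)
  then have "f \<in> orlicz_space (primitive a)" by (simp add: orlicz_space_def fm)
  moreover have "almost_compact_embedding (orlicz_norm (primitive a)) (lambda_norm E)"
    unfolding a_def by (intro almost_compact_embedding_primitive E m fin)
  ultimately show ?thesis using that Y by blast
qed

text \<open>For \<open>\<lambda> \<ge> n\<close> the distribution function of \<open>g\<close> is that of its restriction to \<open>{\<bar>g\<bar> > n}\<close>, whose norm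
  is finite for some \<open>n\<close>; the levels \<open>\<lambda> < n\<close> contribute at most \<open>n P 1\<close>.\<close>

lemma almost_compact_embedding_imp_subset:
  assumes E: "quasi_convex E" "finite_valued E"
    and ac: "almost_compact_embedding (orlicz_norm A) (lambda_norm E)" and f: "f \<in> orlicz_space A"
  shows "f \<in> lambda_space E"
proof -
  have fm[measurable]: "f \<in> borel_measurable unit_interval" and fo: "orlicz_norm A f < \<infinity>"
    using f by (auto simp: orlicz_space_def)
  obtain r where r: "0 < r" "r < \<infinity>" "(\<integral>\<^sup>+x. A (ennreal \<bar>f x\<bar> / r) \<partial>unit_interval) \<le> 1"
    using fo unfolding orlicz_norm_def Inf_less_iff by auto
  obtain r' where r': "r = ennreal r'" "0 < r'" using r by (cases r) auto
  define g where "g = (\<lambda>x. f x / r')"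
  have g[measurable]: "g \<in> borel_measurable unit_interval" unfolding g_def by measurable
  have "ennreal \<bar>g x\<bar> = ennreal \<bar>f x\<bar> / r" for x
    using r' by (simp add: g_def divide_ennreal)
  then have "orlicz_norm A g \<le> 1"
    unfolding orlicz_norm_def using r by (intro Inf_lower) (auto simp: divide_ennreal_def)
  define S where "S n = {x \<in> {0<..<1}. \<bar>g x\<bar> > real n}" for n
  have S: "S n \<in> sets unit_interval" for n unfolding S_def by (rule distr_fun_sets[OF g])
  let ?F = "\<lambda>n. SUP f \<in> {f \<in> borel_measurable unit_interval. orlicz_norm A f \<le> 1}.
                lambda_norm E (\<lambda>x. f x * indicator (S n) x)"
  have "(\<lambda>n. indicator (S n) x :: real) \<longlonglongrightarrow> 0" for x
  proof (rule tendsto_eventually)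
    show "\<forall>\<^sub>F n in sequentially. indicator (S n) x = (0::real)"
      using eventually_ge_at_top[of "nat \<lceil>\<bar>g x\<bar>\<rceil>"]
      by eventually_elim (auto simp: indicator_def S_def)
  qed
  then have "?F \<longlonglongrightarrow> 0" using ac S unfolding almost_compact_embedding_def by blast
  then have "\<forall>\<^sub>F n in sequentially. ?F n < 1" by (rule order_tendstoD) simp
  then obtain n where n: "?F n < 1" by (auto simp: eventually_sequentially)
  have "lambda_norm E (\<lambda>x. g x * indicator (S n) x) \<le> ?F n"
    using \<open>orlicz_norm A g \<le> 1\<close> g by (intro SUP_upper) auto
  also note n
  also have "(1::ennreal) < \<infinity>" by simp
  finally have gS: "lambda_norm E (\<lambda>x. g x * indicator (S n) x) < \<infinity>" .
  let ?P = "sharp_inverse E"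
  have gm: "(\<lambda>x. g x * indicator (S n) x) \<in> borel_measurable unit_interval"
    using S by (intro borel_measurable_times g) auto
  have [measurable]: "(\<lambda>l. ?P (distr_fun (\<lambda>x. g x * indicator (S n) x) l)) \<in> borel_measurable borel"
    by (intro borel_measurable_antimono_ennreal antimono_sharp_inverse_distr_fun gm)
  have eq: "distr_fun (\<lambda>x. g x * indicator (S n) x) l = distr_fun g l" if "real n \<le> l" for l
    unfolding distr_fun_def using that
    by (intro arg_cong[where f = "emeasure unit_interval"]) (auto simp: S_def indicator_def)
  have "lambda_norm E g \<le> (\<integral>\<^sup>+l. ?P 1 * indicator {0<..real n} l +
      ?P (distr_fun (\<lambda>x. g x * indicator (S n) x) l) * indicator {0<..} l \<partial>lborel)"
    unfolding lambda_norm_def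
  proof (rule nn_integral_mono)
    fix l
    show "?P (distr_fun g l) * indicator {0<..} l \<le> ?P 1 * indicator {0<..real n} l +
      ?P (distr_fun (\<lambda>x. g x * indicator (S n) x) l) * indicator {0<..} l"
      using sharp_inverse_mono[OF distr_fun_le_1[of g l], of E] eq[of l]
      by (cases "l \<le> real n") (auto simp: indicator_def add_increasing2)
  qed
  also have "\<dots> = ?P 1 * ennreal (real n) + lambda_norm E (\<lambda>x. g x * indicator (S n) x)"
    by (simp add: nn_integral_add nn_integral_cmult_indicator lambda_norm_def)
  also have "\<dots> < \<infinity>"
    using gS sharp_inverse_less_top[OF E, of 1] by (simp add: less_top[symmetric] ennreal_mult_eq_top_iff)
  finally have "lambda_norm E g < \<infinity>" .
  moreover have "lambda_norm E f = ennreal r' * lambda_norm E g"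
    using lambda_norm_cmult[OF g r'(2), of E] r' by (simp add: g_def)
  ultimately show ?thesis by (simp add: lambda_space_def fm ennreal_mult_less_top)
qed

theorem corollaryA6:
  fixes E :: "ennreal \<Rightarrow> ennreal"
  assumes "quasi_convex E" and "finite_valued E" and "nabla2_near_infinity E"
  shows "lambda_space E =
    \<Union> {orlicz_space A | A. young_function A \<and>
         almost_compact_embedding (orlicz_norm A) (lambda_norm E)}"
proof (intro equalityI subsetI)
  fix f assume "f \<in> lambda_space E"
  then show "f \<in> \<Union> {orlicz_space A | A. young_function A \<and>
         almost_compact_embedding (orlicz_norm A) (lambda_norm E)}"
    using lambda_space_sub_diagonal[OF assms] by blast
next
  fix f assume "f \<in> \<Union> {orlicz_space A | A. young_function A \<and>
         almost_compact_embedding (orlicz_norm A) (lambda_norm E)}"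
  then show "f \<in> lambda_space E"
    using almost_compact_embedding_imp_subset[OF assms(1,2)] by blast
qed

end
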